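(* Let $d \ge 2$ be an integer and $p$ a prime, and let \[\mathcal{P}_0^+ := \bigl\{ \sigma p^e : \sigma \in \{\pm 1\},\ e \in \mathbb{Z},\ e\ge 0 \bigr\}.\] For $a\in \mathbb{Q}^*$ and $b\in \mathcal{P}_0^+$, let $\psi_{d,a,b}:\mathbb{P}^1 \to \mathbb{P}^1$ be the rational map \[ \psi_{d,a,b} (z) = \frac{z}{az^d+b}.\] Then every rational periodic cycle of $\psi_{d,a,b}$ has length at most $2$.
   Context: In homogeneous coordinates $\psi_{d,a,b}([X,Y]) = [XY^{d-1}, aX^d+bY^d]$. A rational periodic cycle of length $n$ is a set $\{z_1,\dots,z_n\}$ of $n$ distinct points of $\mathbb{P}^1(\mathbb{Q})$ with $\psi_{d,a,b}(z_i)=z_{i+1}$ for $1\le i<n$ and $\psi_{d,a,b}(z_n)=z_1$. *)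

theory Defs
  imports Complex_Main "HOL-Computational_Algebra.Primes"
begin

definition proj_rel :: "((rat \<times> rat) \<times> (rat \<times> rat)) set" where
  "proj_rel = {((X, Y), (X', Y')). (X, Y) \<noteq> (0, 0) \<and> (X', Y') \<noteq> (0, 0) \<and>
     (\<exists>c. c \<noteq> 0 \<and> X' = c * X \<and> Y' = c * Y)}"

definition P1Q :: "(rat \<times> rat) set set" where
  "P1Q = (UNIV - {(0, 0)}) // proj_rel"

definition hpoint :: "rat \<Rightarrow> rat \<Rightarrow> (rat \<times> rat) set" where
  "hpoint X Y = proj_rel `` {(X, Y)}"

text \<open>The union runs over all representatives of the point; it is a single class
  for \<open>d \<ge> 2\<close>, \<open>a \<noteq> 0\<close>, \<open>b \<noteq> 0\<close> (lemmas \<open>psi_hpoint\<close>, \<open>psi_nonzero\<close>).\<close>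

definition psi :: "nat \<Rightarrow> rat \<Rightarrow> rat \<Rightarrow> (rat \<times> rat) set \<Rightarrow> (rat \<times> rat) set" where
  "psi d a b P = (\<Union>(X, Y) \<in> P. hpoint (X * Y ^ (d - 1)) (a * X ^ d + b * Y ^ d))"

definition rational_periodic_cycle ::
    "nat \<Rightarrow> rat \<Rightarrow> rat \<Rightarrow> nat \<Rightarrow> (rat \<times> rat) set set \<Rightarrow> bool" where
  "rational_periodic_cycle d a b n C \<longleftrightarrow> n \<ge> 1 \<and>
     (\<exists>z :: nat \<Rightarrow> (rat \<times> rat) set.
        C = z ` {1..n} \<and> C \<subseteq> P1Q \<and> inj_on z {1..n} \<and>
        (\<forall>i\<in>{1..<n}. psi d a b (z i) = z (i + 1)) \<and> psi d a b (z n) = z 1)"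

definition P0plus :: "nat \<Rightarrow> rat set" where
  "P0plus p = {\<sigma> * of_nat p powi e | \<sigma> e. \<sigma> \<in> {1, -1} \<and> e \<ge> 0}"

lemma equiv_proj_rel: "equiv (UNIV - {(0, 0)}) proj_rel"
proof (rule equivI)
  show "refl_on (UNIV - {(0, 0)}) proj_rel"
    by (auto simp: refl_on_def proj_rel_def intro!: exI[of _ 1])
  show "proj_rel \<subseteq> (UNIV - {(0, 0)}) \<times> (UNIV - {(0, 0)})"
    by (auto simp: proj_rel_def)
  show "sym proj_rel"
  proof (rule symI)
    fix u v assume "(u, v) \<in> proj_rel"
    then obtain X Y c where uv: "u = (X, Y)" "v = (c * X, c * Y)" "(X, Y) \<noteq> (0, 0)" "c \<noteq> 0"
      by (auto simp: proj_rel_def)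
    then show "(v, u) \<in> proj_rel"
      by (auto simp: proj_rel_def intro!: exI[of _ "inverse c"])
  qed
  show "trans proj_rel"
  proof (rule transI)
    fix u v w assume "(u, v) \<in> proj_rel" "(v, w) \<in> proj_rel"
    then obtain X Y c e where "u = (X, Y)" "w = (e * (c * X), e * (c * Y))"
      "(X, Y) \<noteq> (0, 0)" "c \<noteq> 0" "e \<noteq> 0"
      by (auto simp: proj_rel_def)
    then show "(u, w) \<in> proj_rel"
      by (auto simp: proj_rel_def intro!: exI[of _ "e * c"])
  qed
qed

lemma hpoint_in_P1Q: "(X, Y) \<noteq> (0, 0) \<Longrightarrow> hpoint X Y \<in> P1Q"
  by (auto simp: hpoint_def P1Q_def intro: quotientI)

lemma hpoint_scale:
  assumes "c \<noteq> 0"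
  shows "hpoint (c * X) (c * Y) = hpoint X Y"
proof (cases "(X, Y) = (0, 0)")
  case False
  then have "((X, Y), (c * X, c * Y)) \<in> proj_rel"
    using assms by (auto simp: proj_rel_def)
  then show ?thesis
    unfolding hpoint_def using equiv_class_eq[OF equiv_proj_rel] by metis
qed auto

lemma psi_nonzero:
  fixes a b X Y :: rat
  assumes "d \<ge> 2" "a \<noteq> 0" "b \<noteq> 0" "(X, Y) \<noteq> (0, 0)"
  shows "(X * Y ^ (d - 1), a * X ^ d + b * Y ^ d) \<noteq> (0, 0)"
  using assms by (auto simp: zero_power)

lemma psi_hpoint:
  assumes "d \<ge> 2" "(X, Y) \<noteq> (0, 0)"
  shows "psi d a b (hpoint X Y) = hpoint (X * Y ^ (d - 1)) (a * X ^ d + b * Y ^ d)"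
proof -
  obtain m where d: "d = Suc m" using assms by (cases d) auto
  have step: "hpoint (c * X * (c * Y) ^ (d - 1)) (a * (c * X) ^ d + b * (c * Y) ^ d)
      = hpoint (X * Y ^ (d - 1)) (a * X ^ d + b * Y ^ d)" if "c \<noteq> 0" for c
  proof -
    have eqs: "c * X * (c * Y) ^ (d - 1) = c ^ d * (X * Y ^ (d - 1))"
      "a * (c * X) ^ d + b * (c * Y) ^ d = c ^ d * (a * X ^ d + b * Y ^ d)"
      by (simp_all add: d power_mult_distrib algebra_simps)
    have "c ^ d \<noteq> 0" using that by simp
    then show ?thesis unfolding eqs by (rule hpoint_scale)
  qed
  have mem: "(X', Y') \<in> hpoint X Y \<longleftrightarrow> (\<exists>c. c \<noteq> 0 \<and> X' = c * X \<and> Y' = c * Y)" for X' Y'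
    using assms(2) by (auto simp: hpoint_def proj_rel_def)
  have self: "(X, Y) \<in> hpoint X Y"
    unfolding mem by (rule exI[of _ 1]) simp
  have "hpoint (X' * Y' ^ (d - 1)) (a * X' ^ d + b * Y' ^ d)
      = hpoint (X * Y ^ (d - 1)) (a * X ^ d + b * Y ^ d)" if "(X', Y') \<in> hpoint X Y" for X' Y'
    using that step unfolding mem by auto
  then have "(case u of (X', Y') \<Rightarrow> hpoint (X' * Y' ^ (d - 1)) (a * X' ^ d + b * Y' ^ d))
      = hpoint (X * Y ^ (d - 1)) (a * X ^ d + b * Y ^ d)" if "u \<in> hpoint X Y" for u
    using that by (cases u) simp
  moreover have "hpoint X Y \<noteq> {}" using self by blast
  ultimately show ?thesis
    unfolding psi_def by (simp cong: SUP_cong)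
qed

lemma psi_affine:
  assumes "d \<ge> 2" "a * z ^ d + b \<noteq> 0"
  shows "psi d a b (hpoint z 1) = hpoint (z / (a * z ^ d + b)) 1"
  using psi_hpoint[OF assms(1), of z 1 a b] assms(2)
    hpoint_scale[of "a * z ^ d + b" "z / (a * z ^ d + b)" 1]
  by simp

end

theory Submission
  imports Defs "HOL-Computational_Algebra.Squarefree"
begin

text \<open>
  In the coordinate \<open>u = 1/z\<close> the map reads \<open>u' * u ^ (d - 1) = a + b * u ^ d\<close>, and neither
  \<open>0\<close> nor \<open>\<infinity>\<close> lies on a cycle of length at least 2. For each prime \<open>q\<close> not dividing \<open>b\<close>, the
  \<open>q\<close>-adic valuation is constant along a cycle: where it is below \<open>v(a) / d\<close>, the term \<open>b * u ^ d\<close>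
  dominates and the valuation never changes again; where it is above \<open>v(a) / d\<close>, the next one is
  below. Hence all the \<open>|u|\<close> on the cycle agree up to powers of \<open>p\<close>. If they are all equal, the
  cycle has at most two points. Otherwise \<open>p\<close> divides \<open>b\<close>, so \<open>\<beta> = |b| \<ge> 2\<close>, and the largest \<open>|u|\<close>
  is \<open>R \<ge> 2\<close> times another one. Estimating \<open>|a|\<close> from below at the first and from above at the
  second point gives \<open>(\<beta> - 1) * R ^ d \<le> \<beta> + R\<close>, which forces \<open>d = 2\<close> and equality in all
  estimates; then \<open>|u'| = |u|\<close> at the largest point, and \<open>u\<close> lies on a cycle of length at most 2
  because the map is odd for even \<open>d\<close>.
\<close>

section \<open>Valuations on the rationals\<close>

text \<open>The junk value at zero is \<open>padic_val q 0 = 0\<close>.\<close>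

definition padic_val :: "nat \<Rightarrow> rat \<Rightarrow> int" where
  "padic_val q x = (let (m, n) = quotient_of x
     in int (multiplicity (int q) m) - int (multiplicity (int q) n))"

lemma padic_val_divide:
  assumes "prime q" "m \<noteq> 0" "n \<noteq> 0"
  shows "padic_val q (of_int m / of_int n) =
    int (multiplicity (int q) m) - int (multiplicity (int q) n)"
proof -
  define x :: rat where "x = of_int m / of_int n"
  obtain k l where kl: "quotient_of x = (k, l)" by force
  have l: "l > 0" and x: "x = of_int k / of_int l"
    using quotient_of_denom_pos[OF kl] quotient_of_div[OF kl] by simp_all
  have k: "k \<noteq> 0" using x assms by (auto simp: x_def)
  have "(of_int (m * l) :: rat) = of_int (k * n)"
    using x l assms by (simp add: x_def field_simps)
  then have "m * l = k * n" by (simp only: of_int_eq_iff)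
  then have "multiplicity (int q) (m * l) = multiplicity (int q) (k * n)" by simp
  then have "multiplicity (int q) m + multiplicity (int q) l =
      multiplicity (int q) k + multiplicity (int q) n"
    using assms k l by (simp add: prime_elem_multiplicity_mult_distrib)
  then show ?thesis by (simp add: padic_val_def kl flip: x_def)
qed

lemma rat_common_denominator:
  fixes x y :: rat
  obtains m k n where "n \<noteq> 0" "x = of_int m / of_int n" "y = of_int k / of_int n"
proof -
  obtain m1 n1 m2 n2 where q: "quotient_of x = (m1, n1)" "quotient_of y = (m2, n2)"
    by (meson surj_pair)
  then have "n1 > 0" "n2 > 0" by (auto dest: quotient_of_denom_pos)
  then show thesis
    using that[of "n1 * n2" "m1 * n2" "m2 * n1"] quotient_of_div[OF q(1)] quotient_of_div[OF q(2)]
    by simp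
qed

lemma padic_val_1 [simp]: "padic_val q 1 = 0"
  by (simp add: padic_val_def)

lemma padic_val_minus [simp]: "padic_val q (- x) = padic_val q x"
  by (simp add: padic_val_def rat_uminus_code split: prod.splits)

lemma padic_val_abs [simp]: "padic_val q \<bar>x\<bar> = padic_val q x"
  by (simp add: abs_if)

lemma padic_val_mult:
  assumes "prime q" "x \<noteq> 0" "y \<noteq> 0"
  shows "padic_val q (x * y) = padic_val q x + padic_val q y"
proof -
  obtain m k n where frac: "n \<noteq> 0" "x = of_int m / of_int n" "y = of_int k / of_int n"
    by (rule rat_common_denominator)
  have nz: "m \<noteq> 0" "k \<noteq> 0" using frac assms by auto
  have "x * y = of_int (m * k) / of_int (n * n)" using frac by simp
  then show ?thesis
    using assms frac nz padic_val_divide[of q "m * k" "n * n"]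
    by (simp add: padic_val_divide prime_elem_multiplicity_mult_distrib)
qed

lemma padic_val_power:
  assumes "prime q" "x \<noteq> 0"
  shows "padic_val q (x ^ k) = int k * padic_val q x"
  using assms by (induction k) (simp_all add: padic_val_mult algebra_simps)

lemma padic_val_prime_power:
  assumes "prime p" "prime q"
  shows "padic_val q (of_nat p ^ k) = (if q = p then int k else 0)"
proof -
  have "padic_val q (of_nat p) = int (multiplicity (int q) (int p))"
    using assms padic_val_divide[of q "int p" 1] by auto
  then show ?thesis
    using assms by (auto simp: padic_val_power prime_multiplicity_other)
qed

lemma padic_val_add_eq:
  assumes q: "prime q" and nz: "x \<noteq> 0" "y \<noteq> 0" and less: "padic_val q x < padic_val q y"
  shows "padic_val q (x + y) = padic_val q x"
proof -
  obtain m k n where frac: "n \<noteq> 0" "x = of_int m / of_int n" "y = of_int k / of_int n"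
    by (rule rat_common_denominator)
  have mk: "m \<noteq> 0" "k \<noteq> 0" using frac nz by auto
  have mult_less: "multiplicity (int q) m < multiplicity (int q) k"
    using less q frac mk by (simp add: padic_val_divide)
  then have "multiplicity (int q) (m + k) = multiplicity (int q) m"
    using mk by (rule multiplicity_sum_lt)
  moreover have "m + k \<noteq> 0"
  proof
    assume "m + k = 0"
    then have "k = - m" by simp
    then show False using mult_less by simp
  qed
  moreover have "x + y = of_int (m + k) / of_int n"
    using frac by (simp add: add_divide_distrib)
  ultimately show ?thesis
    using q frac mk padic_val_divide[of q "m + k" n] by (simp add: padic_val_divide)
qed

lemma abs_eq_if_padic_val_eq:
  assumes nz: "x \<noteq> 0" "y \<noteq> 0" and val: "\<And>q. prime q \<Longrightarrow> padic_val q x = padic_val q y"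
  shows "\<bar>x\<bar> = \<bar>y\<bar>"
proof -
  obtain m k n where frac: "n \<noteq> 0" "x = of_int m / of_int n" "y = of_int k / of_int n"
    by (rule rat_common_denominator)
  have mk: "m \<noteq> 0" "k \<noteq> 0" using frac nz by auto
  have "multiplicity r m = multiplicity r k" if "prime r" for r
  proof -
    have "prime (nat r)" and "int (nat r) = r" using \<open>prime r\<close> by (simp_all add: prime_ge_0_int)
    then show ?thesis using val[of "nat r"] frac mk by (simp add: padic_val_divide)
  qed
  then have "\<bar>m\<bar> = \<bar>k\<bar>" using multiplicity_eq_imp_eq[OF mk] by simp
  then show ?thesis using frac by (simp add: abs_divide flip: of_int_abs)
qed

lemma abs_eq_prime_power_mult:
  assumes p: "prime p" and nz: "x \<noteq> 0" "y \<noteq> 0"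
    and val: "\<And>q. prime q \<Longrightarrow> q \<noteq> p \<Longrightarrow> padic_val q x = padic_val q y"
    and val_p: "padic_val p x \<le> padic_val p y"
  shows "\<bar>y\<bar> = of_nat p ^ nat (padic_val p y - padic_val p x) * \<bar>x\<bar>"
proof -
  define k where "k = nat (padic_val p y - padic_val p x)"
  have pk: "(of_nat p :: rat) ^ k \<noteq> 0" using p by auto
  have "padic_val q y = padic_val q (of_nat p ^ k * x)" if "prime q" for q
    using val[OF that] val_p padic_val_mult[OF that pk nz(1)]
    by (simp add: padic_val_prime_power[OF p that] k_def)
  then have "\<bar>y\<bar> = \<bar>of_nat p ^ k * x\<bar>"
    using nz pk by (intro abs_eq_if_padic_val_eq) auto
  then show ?thesis by (simp add: abs_mult k_def)
qed

lemma prime_mult_abs_le_if_abs_less: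
  assumes p: "prime p" and nz: "x \<noteq> 0" "y \<noteq> 0"
    and val: "\<And>q. prime q \<Longrightarrow> q \<noteq> p \<Longrightarrow> padic_val q x = padic_val q y"
    and less: "\<bar>x\<bar> < \<bar>y\<bar>"
  shows "of_nat p * \<bar>x\<bar> \<le> \<bar>y\<bar>"
proof (cases "padic_val p x \<le> padic_val p y")
  case True
  define k where "k = nat (padic_val p y - padic_val p x)"
  have y: "\<bar>y\<bar> = of_nat p ^ k * \<bar>x\<bar>"
    unfolding k_def using p nz val True by (rule abs_eq_prime_power_mult)
  then have "k \<noteq> 0" using less by (intro notI) simp
  then have "of_nat p ^ 1 \<le> (of_nat p ^ k :: rat)"
    using prime_ge_1_nat[OF p] by (intro power_increasing) auto
  then show ?thesis unfolding y by (intro mult_right_mono) auto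
next
  case False
  then have "\<bar>x\<bar> = of_nat p ^ nat (padic_val p x - padic_val p y) * \<bar>y\<bar>"
    using p nz val by (intro abs_eq_prime_power_mult) auto
  also have "\<dots> \<ge> 1 * \<bar>y\<bar>"
    using prime_ge_1_nat[OF p] by (intro mult_right_mono one_le_power) auto
  finally show ?thesis using less by simp
qed

section \<open>Periodic sequences\<close>

definition periodic :: "nat \<Rightarrow> (nat \<Rightarrow> 'a) \<Rightarrow> bool" where
  "periodic n f \<longleftrightarrow> 0 < n \<and> (\<forall>i. f (i + n) = f i)"

lemma periodic_compose: "periodic n f \<Longrightarrow> periodic n (\<lambda>i. g (f i))"
  by (simp add: periodic_def)

lemma periodic_add_mult:
  assumes "periodic n f"
  shows "f (i + k * n) = f i"
proof (induction k)
  case (Suc k)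
  have "f (i + Suc k * n) = f ((i + k * n) + n)" by (simp add: algebra_simps)
  also have "\<dots> = f i" using assms Suc by (simp add: periodic_def)
  finally show ?case .
qed simp

lemma periodic_const_if_eventually_const:
  assumes "periodic n f" and "\<And>i. m \<le> i \<Longrightarrow> f i = c"
  shows "f i = c"
proof -
  have "0 < n" using assms(1) by (simp add: periodic_def)
  then have "m \<le> i + m * n" by (simp add: trans_le_add2)
  then show ?thesis using periodic_add_mult[OF assms(1), of i m] assms(2) by simp
qed

lemma periodic_obtains_max:
  fixes f :: "nat \<Rightarrow> 'a :: linorder"
  assumes "periodic n f"
  obtains m where "\<And>i. f i \<le> f m"
proof -
  have n: "0 < n" using assms by (simp add: periodic_def)
  have fin: "finite (f ` {..<n})" "f ` {..<n} \<noteq> {}" using n by (auto simp: lessThan_empty_iff)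
  obtain m where m: "f m = Max (f ` {..<n})" using Max_in[OF fin] by auto
  have "f i \<le> f m" for i
  proof -
    have "f i = f (i mod n)" using periodic_add_mult[OF assms, of "i mod n" "i div n"] by simp
    also have "\<dots> \<le> f m" unfolding m using n by (intro Max_ge) auto
    finally show ?thesis .
  qed
  then show thesis by (rule that)
qed

lemma periodic_const_if_piecewise_affine:
  fixes f :: "nat \<Rightarrow> 'a :: linordered_idom"
  assumes per: "periodic n f" and D: "1 < D"
    and below: "\<And>i. D * f i < A \<Longrightarrow> f (Suc i) = f i"
    and above: "\<And>i. D * f i > A \<Longrightarrow> f (Suc i) = A - (D - 1) * f i"
  shows "f i = f j"
proof (cases "\<exists>m. D * f m < A")
  case True
  then obtain m where m: "D * f m < A" ..
  have "f i = f m" if "m \<le> i" for i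
    using that by (induction i rule: dec_induct) (use m below in auto)
  then show ?thesis using periodic_const_if_eventually_const[OF per] by metis
next
  case False
  have "D * f k = A" for k
  proof (rule ccontr)
    assume "D * f k \<noteq> A"
    with False have gt: "D * f k > A" by (metis linorder_neqE)
    have "D * f (Suc k) = D * A - (D - 1) * (D * f k)"
      using arg_cong[OF above[OF gt], of "(*) D"] by (simp add: algebra_simps)
    also have "\<dots> < D * A - (D - 1) * A"
      using gt D by simp
    also have "\<dots> = A" by (simp add: algebra_simps)
    finally show False using False by blast
  qed
  then have "D * f i = D * f j" by simp
  then show ?thesis using D by simp
qed

section \<open>The archimedean estimate\<close>

lemma extremal_ratio:
  fixes R \<rho> \<beta> :: "'a :: linordered_field"
  assumes R: "2 \<le> R" and \<beta>: "2 \<le> \<beta>" and \<rho>: "\<rho> \<le> R" and k: "1 \<le> k"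
    and bound: "R ^ k * (\<beta> * R - \<rho>) \<le> \<beta> + R"
  shows "k = 1" and "\<rho> = R"
proof -
  have "0 \<le> (R\<^sup>2 - 1) * (\<beta> - 2) + (R - 2) * (R + 1)"
    using R \<beta> by (intro add_nonneg_nonneg mult_nonneg_nonneg) (auto simp: one_le_power)
  also have "\<dots> = R * (\<beta> * R - R) - (\<beta> + R)"
    by (simp add: algebra_simps power2_eq_square)
  finally have lower: "\<beta> + R \<le> R * (\<beta> * R - R)" by simp
  have mono_\<rho>: "R * (\<beta> * R - R) \<le> R * (\<beta> * R - \<rho>)"
    using R \<rho> by (intro mult_left_mono) auto
  then have "0 < R * (\<beta> * R - \<rho>)" using lower R \<beta> by linarith
  then have pos: "0 < \<beta> * R - \<rho>" using R by (simp add: zero_less_mult_iff)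
  have "R ^ 1 \<le> R ^ k" using R k by (intro power_increasing) auto
  then have mono_k: "R * (\<beta> * R - \<rho>) \<le> R ^ k * (\<beta> * R - \<rho>)"
    using pos by (intro mult_right_mono) auto
  have "R ^ k * (\<beta> * R - \<rho>) = R ^ 1 * (\<beta> * R - \<rho>)"
    using mono_k mono_\<rho> lower bound by (simp only: power_one_right)
  then have "R ^ k = R ^ 1" using pos by simp
  then show "k = 1" using R by (subst (asm) power_inject_exp) auto
  have "R * (\<beta> * R - R) = R * (\<beta> * R - \<rho>)"
    using mono_k mono_\<rho> lower bound by linarith
  then show "\<rho> = R" using R by simp
qed

lemma extremal_image:
  fixes a b x x' y y' :: "'a :: linordered_field"
  assumes x: "x' * x ^ (d - 1) = a + b * x ^ d" and y: "y' * y ^ (d - 1) = a + b * y ^ d"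
    and le_x: "\<bar>x'\<bar> \<le> \<bar>x\<bar>" "\<bar>y'\<bar> \<le> \<bar>x\<bar>" and gap: "2 * \<bar>y\<bar> \<le> \<bar>x\<bar>"
    and "y \<noteq> 0" "2 \<le> \<bar>b\<bar>" "2 \<le> d"
  shows "d = 2" and "\<bar>x'\<bar> = \<bar>x\<bar>"
proof -
  obtain k where k: "d = Suc k" "1 \<le> k" using \<open>2 \<le> d\<close> by (cases d) auto
  define \<mu> R \<rho> where "\<mu> = \<bar>y\<bar>" and "R = \<bar>x\<bar> / \<mu>" and "\<rho> = \<bar>x'\<bar> / \<mu>"
  have \<mu>: "0 < \<mu>" using \<open>y \<noteq> 0\<close> by (simp add: \<mu>_def)
  have abs_x: "\<bar>x\<bar> = R * \<mu>" "\<bar>x'\<bar> = \<rho> * \<mu>" using \<mu> by (simp_all add: R_def \<rho>_def)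
  have R: "2 \<le> R" and \<rho>: "\<rho> \<le> R" using gap le_x(1) \<mu> by (simp_all add: abs_x flip: \<mu>_def)
  have "\<bar>b * x ^ d\<bar> - \<bar>x' * x ^ k\<bar> \<le> \<bar>a\<bar>" using x k by simp
  moreover have "\<bar>a\<bar> \<le> \<bar>b * y ^ d\<bar> + \<bar>y' * y ^ k\<bar>" using y k by simp
  ultimately have "\<bar>b * x ^ d\<bar> - \<bar>x' * x ^ k\<bar> \<le> \<bar>b * y ^ d\<bar> + \<bar>y' * y ^ k\<bar>" by simp
  also have "\<dots> \<le> \<bar>b\<bar> * \<mu> ^ d + (R * \<mu>) * \<mu> ^ k"
    using le_x(2) by (simp add: abs_mult power_abs mult_right_mono abs_x \<mu>_def)
  also have "\<dots> = \<mu> ^ d * (\<bar>b\<bar> + R)" by (simp add: k algebra_simps)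
  also have "\<bar>b * x ^ d\<bar> - \<bar>x' * x ^ k\<bar> = \<mu> ^ d * (R ^ k * (\<bar>b\<bar> * R - \<rho>))"
    by (simp add: abs_mult power_abs abs_x k power_mult_distrib algebra_simps)
  finally have "R ^ k * (\<bar>b\<bar> * R - \<rho>) \<le> \<bar>b\<bar> + R" using \<mu> by simp
  note extremal = extremal_ratio[OF R \<open>2 \<le> \<bar>b\<bar>\<close> \<rho> k(2) this]
  show "d = 2" using extremal(1) k(1) by simp
  show "\<bar>x'\<bar> = \<bar>x\<bar>" using extremal(2) abs_x by simp
qed

section \<open>Cycles in the reciprocal coordinate\<close>

locale reciprocal_cycle =
  fixes d n :: nat and a b :: "'a :: field" and u :: "nat \<Rightarrow> 'a"
  assumes d_ge_2: "2 \<le> d" and a_nonzero: "a \<noteq> 0" and b_nonzero: "b \<noteq> 0"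
    and periodic: "periodic n u" and nonzero: "u i \<noteq> 0"
    and recurrence: "u (Suc i) * u i ^ (d - 1) = a + b * u i ^ d"
begin

lemma Suc_eq_if_eq:
  assumes "u i = u j"
  shows "u (Suc i) = u (Suc j)"
proof -
  have "u (Suc i) * u i ^ (d - 1) = u (Suc j) * u i ^ (d - 1)"
    using recurrence[of i] recurrence[of j] assms by simp
  then show ?thesis using nonzero by simp
qed

lemma return_if_fixed: "u (Suc i) = u i \<Longrightarrow> u (i + 2) = u i"
  using Suc_eq_if_eq[of "Suc i" i] by simp

lemma return_if_negated:
  assumes "even d" and neg: "u (Suc i) = - u i"
  shows "u (i + 2) = u i"
proof -
  have "u (Suc (Suc i)) * u (Suc i) ^ (d - 1) = u (Suc i) * u i ^ (d - 1)"
    using recurrence[of i] recurrence[of "Suc i"] \<open>even d\<close> neg by simp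
  moreover have "u (Suc i) ^ (d - 1) = - (u i ^ (d - 1))"
    using d_ge_2 \<open>even d\<close> neg by simp
  ultimately show ?thesis using neg nonzero by simp
qed

lemma return_if_const_up_to_sign:
  assumes "\<And>i. u (Suc i) = u i \<or> u (Suc i) = - u i"
  shows "\<exists>i. u (i + 2) = u i"
proof -
  consider "u (Suc 0) = u 0" | "u (Suc 1) = u 1" | "u (Suc 0) = - u 0" "u (Suc 1) = - u 1"
    using assms by blast
  then show ?thesis
  proof cases
    case 3
    then have "u (0 + 2) = u 0" by (simp add: numeral_2_eq_2)
    then show ?thesis ..
  qed (use return_if_fixed in blast)+
qed

end

locale rational_reciprocal_cycle = reciprocal_cycle d n a b u
  for d n and a b :: rat and u
begin

lemma padic_val_const:
  assumes q: "prime q" and val_b: "padic_val q b = 0"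
  shows "padic_val q (u i) = padic_val q (u j)"
proof (rule periodic_const_if_piecewise_affine)
  show "periodic n (\<lambda>i. padic_val q (u i))" using periodic by (rule periodic_compose)
  show "1 < int d" using d_ge_2 by simp
  have val_pow: "padic_val q (b * u i ^ d) = int d * padic_val q (u i)" for i
    using q b_nonzero nonzero val_b by (simp add: padic_val_mult padic_val_power)
  have val_Suc: "padic_val q (u (Suc i)) + (int d - 1) * padic_val q (u i) =
      padic_val q (a + b * u i ^ d)" for i
    using q nonzero d_ge_2
    by (simp add: padic_val_mult padic_val_power of_nat_diff flip: recurrence)
  show "padic_val q (u (Suc i)) = padic_val q (u i)"
    if "int d * padic_val q (u i) < padic_val q a" for i
    using padic_val_add_eq[OF q, of "b * u i ^ d" a] that val_pow[of i] val_Suc[of i]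
      a_nonzero b_nonzero nonzero
    by (simp add: algebra_simps)
  show "padic_val q (u (Suc i)) = padic_val q a - (int d - 1) * padic_val q (u i)"
    if "padic_val q a < int d * padic_val q (u i)" for i
    using padic_val_add_eq[OF q, of a "b * u i ^ d"] that val_pow[of i] val_Suc[of i]
      a_nonzero b_nonzero nonzero
    by (simp add: algebra_simps)
qed

lemma abs_gap:
  assumes p: "prime p" and b: "\<bar>b\<bar> = of_nat p ^ k" and less: "\<bar>u i\<bar> < \<bar>u j\<bar>"
  shows "2 * \<bar>u i\<bar> \<le> \<bar>u j\<bar>" and "2 \<le> \<bar>b\<bar>"
proof -
  have p2: "2 \<le> (of_nat p :: rat)"
    using prime_ge_2_nat[OF p] of_nat_mono by fastforce
  have val_b: "padic_val q b = (if q = p then int k else 0)" if "prime q" for q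
    using padic_val_prime_power[OF p that, of k] by (simp flip: b)
  have "of_nat p * \<bar>u i\<bar> \<le> \<bar>u j\<bar>"
    using p nonzero nonzero _ less
  proof (rule prime_mult_abs_le_if_abs_less)
    show "padic_val q (u i) = padic_val q (u j)" if "prime q" "q \<noteq> p" for q
      using that val_b by (intro padic_val_const) auto
  qed
  then show "2 * \<bar>u i\<bar> \<le> \<bar>u j\<bar>"
    using mult_right_mono[OF p2, of "\<bar>u i\<bar>"] by simp
  have "k \<noteq> 0"
  proof
    assume "k = 0"
    then have "\<bar>u i\<bar> = \<bar>u j\<bar>"
      using val_b nonzero by (intro abs_eq_if_padic_val_eq padic_val_const) auto
    then show False using less by simp
  qed
  then have "of_nat p ^ 1 \<le> (of_nat p ^ k :: rat)"
    using p2 by (intro power_increasing) auto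
  then show "2 \<le> \<bar>b\<bar>" using p2 unfolding b power_one_right by (rule order.trans[rotated])
qed

lemma return_in_two_steps:
  assumes p: "prime p" and b: "\<bar>b\<bar> = of_nat p ^ k"
  shows "\<exists>i. u (i + 2) = u i"
proof -
  obtain M where M: "\<And>i. \<bar>u i\<bar> \<le> \<bar>u M\<bar>"
    using periodic_obtains_max[OF periodic_compose[OF periodic, of abs]] by blast
  show ?thesis
  proof (cases "\<exists>m. \<bar>u m\<bar> < \<bar>u M\<bar>")
    case True
    then obtain m where m: "\<bar>u m\<bar> < \<bar>u M\<bar>" ..
    have d: "d = 2" and "\<bar>u (Suc M)\<bar> = \<bar>u M\<bar>"
      using extremal_image[OF recurrence recurrence M M abs_gap(1)[OF p b m] nonzero
        abs_gap(2)[OF p b m] d_ge_2] .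
    then consider "u (Suc M) = u M" | "u (Suc M) = - u M" by (auto simp: abs_eq_iff)
    then have "u (M + 2) = u M"
    proof cases
      case 1
      then show ?thesis by (rule return_if_fixed)
    next
      case 2
      then show ?thesis using d by (intro return_if_negated) simp_all
    qed
    then show ?thesis ..
  next
    case False
    then have abs_const: "\<bar>u i\<bar> = \<bar>u M\<bar>" for i using M by (meson order.antisym not_le)
    have "u (Suc i) = u i \<or> u (Suc i) = - u i" for i
      using abs_const[of i] abs_const[of "Suc i"] by (simp flip: abs_eq_iff)
    then show ?thesis by (rule return_if_const_up_to_sign)
  qed
qed

end

section \<open>Cycles on the projective line\<close>

lemma hpoint_eq_iff:
  assumes "(X, Y) \<noteq> (0, 0)" "(X', Y') \<noteq> (0, 0)"
  shows "hpoint X Y = hpoint X' Y' \<longleftrightarrow> X * Y' = X' * Y"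
proof -
  have "hpoint X Y = hpoint X' Y' \<longleftrightarrow> ((X, Y), (X', Y')) \<in> proj_rel"
    unfolding hpoint_def using assms by (intro eq_equiv_class_iff[OF equiv_proj_rel]) auto
  also have "\<dots> \<longleftrightarrow> X * Y' = X' * Y"
  proof
    assume "((X, Y), (X', Y')) \<in> proj_rel"
    then show "X * Y' = X' * Y" by (auto simp: proj_rel_def)
  next
    assume cross: "X * Y' = X' * Y"
    define c where "c = (if X = 0 then Y' / Y else X' / X)"
    have "c \<noteq> 0" "X' = c * X" "Y' = c * Y"
      using assms cross by (auto simp: c_def field_simps)
    then show "((X, Y), (X', Y')) \<in> proj_rel" using assms by (auto simp: proj_rel_def)
  qed
  finally show ?thesis .
qed

lemma P1Q_cases:
  assumes "P \<in> P1Q"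
  obtains "P = hpoint 0 1" | u where "P = hpoint 1 u"
proof -
  obtain X Y where P: "P = hpoint X Y" "(X, Y) \<noteq> (0, 0)"
    using assms by (auto simp: P1Q_def quotient_def hpoint_def)
  show thesis
  proof (cases "X = 0")
    case True
    then show thesis using P that(1) by (simp add: hpoint_eq_iff)
  next
    case False
    then have "P = hpoint 1 (Y / X)" using P by (simp add: hpoint_eq_iff)
    then show thesis by (rule that(2))
  qed
qed

lemma psi_zero: "2 \<le> d \<Longrightarrow> b \<noteq> 0 \<Longrightarrow> psi d a b (hpoint 0 1) = hpoint 0 1"
  by (simp add: psi_hpoint hpoint_eq_iff zero_power)

lemma psi_infinity: "2 \<le> d \<Longrightarrow> a \<noteq> 0 \<Longrightarrow> psi d a b (hpoint 1 0) = hpoint 0 1"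
  by (simp add: psi_hpoint hpoint_eq_iff zero_power)

lemma psi_reciprocal_eq_iff:
  assumes "2 \<le> d" "u \<noteq> 0"
  shows "psi d a b (hpoint 1 u) = hpoint 1 v \<longleftrightarrow> v * u ^ (d - 1) = a + b * u ^ d"
  using assms by (simp add: psi_hpoint hpoint_eq_iff mult.commute[of v])

lemma rational_periodic_cycle_sequence:
  assumes "rational_periodic_cycle d a b n C"
  obtains w where "\<And>i. w i \<in> P1Q" "\<And>i. psi d a b (w i) = w (Suc i)"
    "\<And>i j. w i = w j \<longleftrightarrow> i mod n = j mod n"
proof -
  obtain z where n: "0 < n" and P1Q: "z ` {1..n} \<subseteq> P1Q" and inj: "inj_on z {1..n}"
    and step: "\<forall>i\<in>{1..<n}. psi d a b (z i) = z (i + 1)" and wrap: "psi d a b (z n) = z 1"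
    using assms unfolding rational_periodic_cycle_def by auto
  define w where "w i = z (Suc (i mod n))" for i
  have index: "Suc (i mod n) \<in> {1..n}" for i using n by (simp add: Suc_leI)
  have "w i \<in> P1Q" for i using P1Q index unfolding w_def by blast
  moreover have "psi d a b (w i) = w (Suc i)" for i
  proof (cases "Suc (i mod n) = n")
    case True
    then show ?thesis using wrap by (simp add: w_def mod_Suc)
  next
    case False
    then have "Suc (i mod n) \<in> {1..<n}" using index[of i] by auto
    then show ?thesis using step False by (simp add: w_def mod_Suc)
  qed
  moreover have "w i = w j \<longleftrightarrow> i mod n = j mod n" for i j
    using inj_on_eq_iff[OF inj index index] by (simp add: w_def)
  ultimately show thesis by (rule that)
qed

lemma rational_periodic_cycle_reciprocal:
  assumes cycle: "rational_periodic_cycle d a b n C"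
    and d: "2 \<le> d" and a: "a \<noteq> 0" and b: "b \<noteq> 0" and n: "2 \<le> n"
  obtains u where "rational_reciprocal_cycle d n a b u"
    "\<And>i j. u i = u j \<longleftrightarrow> i mod n = j mod n"
proof -
  obtain w where P1Q: "\<And>i. w i \<in> P1Q" and step: "\<And>i. psi d a b (w i) = w (Suc i)"
    and w_eq: "\<And>i j. w i = w j \<longleftrightarrow> i mod n = j mod n"
    using cycle by (rule rational_periodic_cycle_sequence) blast
  have not_zero: "w i \<noteq> hpoint 0 1" for i
  proof
    assume "w i = hpoint 0 1"
    then have "w (Suc i) = w i" using step[of i] psi_zero[OF d b] by simp
    then show False using n by (auto simp: w_eq mod_Suc split: if_splits)
  qed
  then have "\<forall>i. \<exists>u. w i = hpoint 1 u" using P1Q P1Q_cases by metis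
  then obtain u where u: "\<And>i. w i = hpoint 1 (u i)" by metis
  have nonzero: "u i \<noteq> 0" for i
  proof
    assume "u i = 0"
    then have "w (Suc i) = hpoint 0 1" using step[of i] psi_infinity[OF d a] by (simp add: u)
    then show False using not_zero by blast
  qed
  have u_eq: "u i = u j \<longleftrightarrow> i mod n = j mod n" for i j
    using w_eq[of i j] by (auto simp: u hpoint_eq_iff)
  have "rational_reciprocal_cycle d n a b u"
  proof
    show "periodic n u" using n by (simp add: periodic_def u_eq)
    show "u (Suc i) * u i ^ (d - 1) = a + b * u i ^ d" for i
      using step[of i] d nonzero by (simp add: u psi_reciprocal_eq_iff)
  qed (use d a b nonzero in auto)
  then show thesis using u_eq by (rule that)
qed

lemma P0plusE:
  assumes "b \<in> P0plus p"
  obtains k where "\<bar>b\<bar> = of_nat p ^ k"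
proof -
  obtain \<sigma> e where "b = \<sigma> * of_nat p powi e" "\<sigma> \<in> {1, -1}" "e \<ge> 0"
    using assms by (auto simp: P0plus_def)
  then have "\<bar>b\<bar> = of_nat p ^ nat e" by (auto simp: abs_mult power_int_def)
  then show thesis by (rule that)
qed

theorem theorem1p5:
  fixes d p :: nat and a b :: rat
  assumes "d \<ge> 2" and "prime p" and "a \<noteq> 0" and "b \<in> P0plus p"
  shows "\<forall>n C. rational_periodic_cycle d a b n C \<longrightarrow> n \<le> 2"
proof (intro allI impI)
  fix n C
  assume cycle: "rational_periodic_cycle d a b n C"
  obtain k where b: "\<bar>b\<bar> = of_nat p ^ k" using assms(4) by (rule P0plusE)
  then have "b \<noteq> 0" using \<open>prime p\<close> by auto
  show "n \<le> 2"
  proof (cases "2 \<le> n")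
    case True
    obtain u where u: "rational_reciprocal_cycle d n a b u"
      and u_eq: "\<And>i j. u i = u j \<longleftrightarrow> i mod n = j mod n"
      using rational_periodic_cycle_reciprocal[OF cycle assms(1,3) \<open>b \<noteq> 0\<close> True] by blast
    obtain i where "u (i + 2) = u i"
      using rational_reciprocal_cycle.return_in_two_steps[OF u \<open>prime p\<close> b] ..
    then have "n dvd 2" using u_eq mod_eq_dvd_iff_nat[of i "i + 2" n] by simp
    then show ?thesis by (simp add: dvd_imp_le)
  qed simp
qed

end
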